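(* Given a permutation $\lambda$ of $\{1,\ldots,n\}$ and a parent function $p:\{1,2,\ldots,n\}\rightarrow \{2,\ldots,n\}\cup\{\infty\}$ (with $p(i)>i$ for all $i$), the pair $(\lambda,p)$ is the largest maximal representation of the tournament induced by $(\lambda,p)$ if and only if for each descent $i$ of $\lambda$, the vertex $\lambda(i+1)$ belongs to the range of $p$.
   Context: A tournament $T$ on $\{1,\ldots,n\}$ has for every pair $\{i,j\}$ exactly one of the edges $i\rightarrow j$, $j\rightarrow i$; an edge $i\rightarrow j$ is an ascent if $i<j$ and a descent if $i>j$. $T$ is alternation acyclic if it has no directed cycle in which ascents and descents alternate. The right alternating walk order $\preceq$ induced by $T$ is defined by $u\preceq v$ if $u=v$ or there is a directed walk from $u$ to $v$ starting with a descent, ending with an ascent, in which descents and ascents alternate; for alternation acyclic $T$ it is a partial order. For a permutation $\pi$ and a parent function $p:\{1,\ldots,n\}\rightarrow\{2,\ldots,n\}\cup\{\infty\}$ with $p(i)>i$, the tournament induced by $(\pi,p)$ has, for all $u<v$, the edge $u\rightarrow v$ if $p(u)\neq\infty$ and $\pi^{-1}(v)\geq\pi^{-1}(p(u))$, and the edge $v\rightarrow u$ otherwise; this tournament is always alternation acyclic, and for every alternation acyclic $T$ and every linear extension $\pi$ of $\preceq$ there is a unique $p$ such that $(\pi,p)$ induces $T$. For an alternation acyclic tournament $T$, the largest maximal order is the permutation $\lambda$ such that for each $k$, $\lambda(k)$ is the largest maximal element of the restriction of $\preceq$ to $\{\lambda(1),\ldots,\lambda(k)\}$; the unique pair $(\lambda,p)$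 inducing $T$ is the largest maximal representation of $T$. An index $i$ is a descent of a permutation $\lambda$ if $\lambda(i)>\lambda(i+1)$. *)

theory Defs
  imports "HOL-Combinatorics.Permutations" "HOL-Library.Extended_Nat"
begin

text \<open>A pair \<open>(i, j)\<close> in the relation is the directed edge from \<open>i\<close> to \<open>j\<close>.\<close>

definition tournament :: "nat \<Rightarrow> nat rel \<Rightarrow> bool" where
  "tournament n T \<longleftrightarrow>
     T \<subseteq> {1..n} \<times> {1..n} \<and>
     (\<forall>i\<in>{1..n}. (i, i) \<notin> T) \<and>
     (\<forall>i\<in>{1..n}. \<forall>j\<in>{1..n}. i \<noteq> j \<longrightarrow> ((i, j) \<in> T \<longleftrightarrow> (j, i) \<notin> T))"

definition ascent :: "nat rel \<Rightarrow> nat \<Rightarrow> nat \<Rightarrow> bool" where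
  "ascent T i j \<longleftrightarrow> (i, j) \<in> T \<and> i < j"

definition descent :: "nat rel \<Rightarrow> nat \<Rightarrow> nat \<Rightarrow> bool" where
  "descent T i j \<longleftrightarrow> (i, j) \<in> T \<and> i > j"

text \<open>A cycle is the list of its pairwise distinct vertices; the edge leaving the last one
  returns to the first, and the alternation is also required across that closing point.\<close>

definition alternating_cycle :: "nat rel \<Rightarrow> nat list \<Rightarrow> bool" where
  "alternating_cycle T c \<longleftrightarrow>
     c \<noteq> [] \<and> distinct c \<and>
     (\<forall>k<length c.
        let u = c ! k; v = c ! ((k + 1) mod length c); w = c ! ((k + 2) mod length c)
        in ascent T u v \<and> descent T v w \<or> descent T u v \<and> ascent T v w)"

definition alternation_acyclic :: "nat rel \<Rightarrow> bool" where
  "alternation_acyclic T \<longleftrightarrow> \<not> (\<exists>c. alternating_cycle T c)"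

text \<open>A walk is the list of its vertices, repetitions allowed.\<close>

definition alternating_walk :: "nat rel \<Rightarrow> nat list \<Rightarrow> bool" where
  "alternating_walk T xs \<longleftrightarrow>
     (\<forall>k. k + 1 < length xs \<longrightarrow> (xs ! k, xs ! (k + 1)) \<in> T) \<and>
     (\<forall>k. k + 2 < length xs \<longrightarrow>
        ascent T (xs ! k) (xs ! (k + 1)) \<and> descent T (xs ! (k + 1)) (xs ! (k + 2)) \<or>
        descent T (xs ! k) (xs ! (k + 1)) \<and> ascent T (xs ! (k + 1)) (xs ! (k + 2)))"

definition right_alternating_walk_le :: "nat rel \<Rightarrow> nat \<Rightarrow> nat \<Rightarrow> bool" where
  "right_alternating_walk_le T u v \<longleftrightarrow>
     u = v \<or>
     (\<exists>xs. 2 \<le> length xs \<and> hd xs = u \<and> last xs = v \<and> alternating_walk T xs \<and>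
        descent T (xs ! 0) (xs ! 1) \<and>
        ascent T (xs ! (length xs - 2)) (xs ! (length xs - 1)))"

definition maximal_elements :: "('a \<Rightarrow> 'a \<Rightarrow> bool) \<Rightarrow> 'a set \<Rightarrow> 'a set" where
  "maximal_elements le S = {x \<in> S. \<forall>y\<in>S. le x y \<longrightarrow> y = x}"

definition parent_function :: "nat \<Rightarrow> (nat \<Rightarrow> enat) \<Rightarrow> bool" where
  "parent_function n p \<longleftrightarrow>
     p ` {1..n} \<subseteq> enat ` {2..n} \<union> {\<infinity>} \<and> (\<forall>i\<in>{1..n}. p i > enat i)"

definition induced_tournament :: "nat \<Rightarrow> (nat \<Rightarrow> nat) \<Rightarrow> (nat \<Rightarrow> enat) \<Rightarrow> nat rel" where
  "induced_tournament n \<pi> p =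
     (let up = (\<lambda>u v. p u \<noteq> \<infinity> \<and> inv \<pi> v \<ge> inv \<pi> (the_enat (p u)))
      in {(u, v). u \<in> {1..n} \<and> v \<in> {1..n} \<and> u < v \<and> up u v} \<union>
         {(v, u). u \<in> {1..n} \<and> v \<in> {1..n} \<and> u < v \<and> \<not> up u v})"

text \<open>The largest maximal element is taken with respect to the usual order of the integers among
  the elements that are maximal for the right alternating walk order.\<close>

definition largest_maximal_order :: "nat \<Rightarrow> nat rel \<Rightarrow> (nat \<Rightarrow> nat) \<Rightarrow> bool" where
  "largest_maximal_order n T \<pi> \<longleftrightarrow>
     tournament n T \<and> alternation_acyclic T \<and> \<pi> permutes {1..n} \<and>
     (\<forall>k\<in>{1..n}.
        let M = maximal_elements (right_alternating_walk_le T) (\<pi> ` {1..k})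
        in \<pi> k \<in> M \<and> (\<forall>x\<in>M. x \<le> \<pi> k))"

definition largest_maximal_representation ::
    "nat \<Rightarrow> nat rel \<Rightarrow> (nat \<Rightarrow> nat) \<Rightarrow> (nat \<Rightarrow> enat) \<Rightarrow> bool" where
  "largest_maximal_representation n T \<pi> p \<longleftrightarrow>
     largest_maximal_order n T \<pi> \<and> parent_function n p \<and> T = induced_tournament n \<pi> p"

definition perm_descent :: "nat \<Rightarrow> (nat \<Rightarrow> nat) \<Rightarrow> nat \<Rightarrow> bool" where
  "perm_descent n \<pi> i \<longleftrightarrow> 1 \<le> i \<and> i < n \<and> \<pi> i > \<pi> (i + 1)"

end

theory Submission
  imports Defs
begin

text \<open>Write \<open>pos = inv lam\<close>. In the tournament induced by \<open>(lam, p)\<close>, a descent \<open>u \<rightarrow> w\<close> followed by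
  an ascent \<open>w \<rightarrow> v\<close> means exactly that \<open>w < u\<close>, \<open>w < v\<close> and \<open>pos u < pos (p w) \<le> pos v\<close>. Hence
  positions strictly increase along the right alternating walk order, which gives acyclicity and
  the maximality of \<open>lam k\<close> among the first \<open>k\<close> entries. If \<open>i\<close> is a descent of \<open>lam\<close> and \<open>lam i\<close> is
  not maximal among the first \<open>i + 1\<close> entries, the first step of a walk to \<open>lam (i + 1)\<close> forces
  \<open>p w = lam (i + 1)\<close>. Conversely, if \<open>x\<close> is larger than a later entry, then at the first entry
  below \<open>x\<close> after \<open>x\<close> there is a descent, and a preimage of that entry under \<open>p\<close> is the middle vertex
  of a walk which shows that \<open>x\<close> is not maximal.\<close>

lemma descent_ascent_induced_tournament_iff:
  "descent (induced_tournament n \<pi> p) u w \<and> ascent (induced_tournament n \<pi> p) w v \<longleftrightarrow>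
     {u, v, w} \<subseteq> {1..n} \<and> w < u \<and> w < v \<and> p w \<noteq> \<infinity> \<and>
     inv \<pi> u < inv \<pi> (the_enat (p w)) \<and> inv \<pi> (the_enat (p w)) \<le> inv \<pi> v"
  unfolding descent_def ascent_def induced_tournament_def Let_def by auto

lemma tournament_induced_tournament: "tournament n (induced_tournament n \<pi> p)"
  unfolding tournament_def induced_tournament_def Let_def by auto

text \<open>Taken two edges at a time, starting from a descent, an alternating cycle would strictly
  increase the position and could never close.\<close>

lemma alternation_acyclic_induced_tournament:
  "alternation_acyclic (induced_tournament n \<pi> p)"
  unfolding alternation_acyclic_def
proof
  let ?T = "induced_tournament n \<pi> p"
  assume "\<exists>c. alternating_cycle ?T c"
  then obtain c where "alternating_cycle ?T c" ..
  define m where "m = length c"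
  define f where "f k = c ! (k mod m)" for k
  have m: "m > 0"
    using \<open>alternating_cycle ?T c\<close> by (simp add: alternating_cycle_def m_def)
  have alt: "ascent ?T (f k) (f (k+1)) \<and> descent ?T (f (k+1)) (f (k+2)) \<or>
        descent ?T (f k) (f (k+1)) \<and> ascent ?T (f (k+1)) (f (k+2))" for k
  proof -
    have "k mod m < length c"
      using m by (simp add: m_def)
    then have "ascent ?T (c ! (k mod m)) (c ! ((k mod m + 1) mod m)) \<and>
          descent ?T (c ! ((k mod m + 1) mod m)) (c ! ((k mod m + 2) mod m)) \<or>
        descent ?T (c ! (k mod m)) (c ! ((k mod m + 1) mod m)) \<and>
          ascent ?T (c ! ((k mod m + 1) mod m)) (c ! ((k mod m + 2) mod m))"
      using \<open>alternating_cycle ?T c\<close> unfolding alternating_cycle_def m_def Let_def by blast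
    then show ?thesis
      by (simp only: f_def mod_add_left_eq)
  qed
  obtain k where k: "descent ?T (f k) (f (k+1))"
    using alt[of 0] by (metis add_0 one_add_one add.assoc)
  have "descent ?T (f (k + 2*j)) (f (k + 2*j + 1)) \<and>
      inv \<pi> (f (k + 2*j)) \<ge> inv \<pi> (f k) + j" for j
  proof (induction j)
    case 0
    show ?case using k by simp
  next
    case (Suc j)
    have eq: "k + 2 * Suc j = k + 2*j + 2" "k + 2*j + 1 + 1 = k + 2*j + 2"
      "k + 2*j + 1 + 2 = k + 2*j + 2 + 1" by simp_all
    have 1: "ascent ?T (f (k + 2*j + 1)) (f (k + 2*j + 2))"
      using alt[of "k + 2*j"] Suc by (auto simp: descent_def ascent_def)
    have 2: "descent ?T (f (k + 2*j + 2)) (f (k + 2*j + 2 + 1))"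
      using alt[of "k + 2*j + 1"] 1 unfolding eq by (auto simp: descent_def ascent_def)
    have "inv \<pi> (f (k + 2*j)) < inv \<pi> (f (k + 2*j + 2))"
      using descent_ascent_induced_tournament_iff[of n \<pi> p] Suc 1 by (meson less_le_trans)
    with Suc 2 show ?case unfolding eq by linarith
  qed
  \<comment> \<open>After \<open>2*m\<close> edges the cycle has been traversed twice, so the start
    is reached again even if \<open>m\<close> is odd.\<close>
  from this[of m] have "inv \<pi> (f (k + 2*m)) \<ge> inv \<pi> (f k) + m" ..
  moreover have "f (k + 2*m) = f k" by (simp add: f_def)
  ultimately show False using m by simp
qed

text \<open>The vertex \<open>w\<close> is the second one of the walk. The first two edges bound the
  position of \<open>p w\<close> by that of the third vertex, and the remaining descent-ascent pairs
  only move to later positions, up to \<open>v\<close>.\<close>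

lemma right_alternating_walk_le_first_step:
  assumes "right_alternating_walk_le (induced_tournament n \<pi> p) u v" and "u \<noteq> v"
  obtains w where "w \<in> {1..n}" "p w \<noteq> \<infinity>"
    "inv \<pi> u < inv \<pi> (the_enat (p w))" "inv \<pi> (the_enat (p w)) \<le> inv \<pi> v"
proof -
  let ?T = "induced_tournament n \<pi> p"
  obtain xs where len: "2 \<le> length xs" and hd: "hd xs = u" and last: "last xs = v"
    and alt: "alternating_walk ?T xs" and desc: "descent ?T (xs ! 0) (xs ! 1)"
    and asc: "ascent ?T (xs ! (length xs - 2)) (xs ! (length xs - 1))"
    using assms unfolding right_alternating_walk_le_def by blast
  let ?l = "length xs"
  have step: "ascent ?T (xs ! k) (xs ! (k+1)) \<and> descent ?T (xs ! (k+1)) (xs ! (k+2)) \<or>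
        descent ?T (xs ! k) (xs ! (k+1)) \<and> ascent ?T (xs ! (k+1)) (xs ! (k+2))"
    if "k + 2 < ?l" for k
    using alt that unfolding alternating_walk_def by blast
  have dir: "if even k then descent ?T (xs ! k) (xs ! (k+1)) else ascent ?T (xs ! k) (xs ! (k+1))"
    if "k + 1 < ?l" for k
    using that
  proof (induction k)
    case 0
    show ?case using desc by simp
  next
    case (Suc k)
    then show ?case
      using step[of k] by (auto simp: descent_def ascent_def split: if_splits)
  qed
  \<comment> \<open>Edges of even index are descents, so the final ascent has odd index. Hence there
    are at least three vertices, and \<open>v\<close> stands at an even index.\<close>
  have "odd (?l - 2)"
  proof
    assume "even (?l - 2)"
    then have "descent ?T (xs ! (?l - 2)) (xs ! (?l - 2 + 1))"
      using dir[of "?l - 2"] len by simp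
    moreover have "?l - 2 + 1 = ?l - 1" using len by simp
    ultimately show False using asc by (simp add: descent_def ascent_def)
  qed
  then have odd: "odd ?l" and len3: "3 \<le> ?l" using len by (auto, presburger)
  have mono: "inv \<pi> (xs ! 2) \<le> inv \<pi> (xs ! (2 + 2*j))" if "2 + 2*j < ?l" for j
    using that
  proof (induction j)
    case (Suc j)
    have "descent ?T (xs ! (2 + 2*j)) (xs ! (2 + 2*j + 1))"
      using dir[of "2 + 2*j"] Suc.prems by simp
    moreover have "ascent ?T (xs ! (2 + 2*j + 1)) (xs ! (2 + 2 * Suc j))"
      using dir[of "2 + 2*j + 1"] Suc.prems by simp
    ultimately have "inv \<pi> (xs ! (2 + 2*j)) < inv \<pi> (xs ! (2 + 2 * Suc j))"
      using descent_ascent_induced_tournament_iff[of n \<pi> p] by (meson less_le_trans)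
    then show ?case using Suc by simp
  qed simp
  obtain j where j: "?l - 1 = 2 + 2*j"
  proof -
    have "even (?l - 3)" using odd len3 by simp
    then obtain j where "?l - 3 = 2*j" by blast
    then have "?l - 1 = 2 + 2*j" using len3 by linarith
    then show ?thesis by (rule that)
  qed
  have ends: "xs ! 0 = u" "xs ! (?l - 1) = v"
  proof -
    have "xs \<noteq> []" using len by auto
    then show "xs ! 0 = u" "xs ! (?l - 1) = v"
      using hd last by (simp_all add: hd_conv_nth last_conv_nth)
  qed
  have "inv \<pi> (xs ! 2) \<le> inv \<pi> v"
    using mono[of j] j ends len by simp
  moreover have "ascent ?T (xs ! 1) (xs ! 2)"
    using dir[of 1] len3 by (simp add: numeral_2_eq_2)
  ultimately show ?thesis
    using that[of "xs ! 1"] desc ends descent_ascent_induced_tournament_iff[of n \<pi> p u "xs ! 1" "xs ! 2"]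
    by auto
qed

lemma right_alternating_walk_le_descent_ascent:
  assumes "descent T u w" "ascent T w v"
  shows "right_alternating_walk_le T u v"
proof -
  have "alternating_walk T [u, w, v]"
    using assms unfolding alternating_walk_def
    by (auto simp: less_Suc_eq descent_def ascent_def nth_Cons')
  then show ?thesis
    using assms unfolding right_alternating_walk_le_def
    by (intro disjI2 exI[of _ "[u, w, v]"]) auto
qed

text \<open>Only the comparison by size is left to check: \<open>lam k\<close> is always maximal,
  because all elements above it have later positions and the first \<open>k\<close> entries contain
  none of these.\<close>

lemma largest_maximal_order_induced_tournament_iff:
  assumes "lam permutes {1..n}"
  shows "largest_maximal_order n (induced_tournament n lam p) lam \<longleftrightarrow>
    (\<forall>k\<in>{1..n}. \<forall>x\<in>maximal_elements
       (right_alternating_walk_le (induced_tournament n lam p)) (lam ` {1..k}). x \<le> lam k)"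
proof -
  have "lam k \<in> maximal_elements
      (right_alternating_walk_le (induced_tournament n lam p)) (lam ` {1..k})"
    if k: "k \<in> {1..n}" for k
    unfolding maximal_elements_def
  proof (intro CollectI conjI ballI impI)
    show "lam k \<in> lam ` {1..k}" using k by auto
  next
    fix y
    assume y: "y \<in> lam ` {1..k}"
      and le: "right_alternating_walk_le (induced_tournament n lam p) (lam k) y"
    show "y = lam k"
    proof (rule ccontr)
      assume "y \<noteq> lam k"
      then obtain w where "inv lam (lam k) < inv lam (the_enat (p w))"
        "inv lam (the_enat (p w)) \<le> inv lam y"
        using right_alternating_walk_le_first_step[OF le] by metis
      then have "inv lam (lam k) < inv lam y"
        by (rule less_le_trans)
      then show False
        using y permutes_inverses(2)[OF assms] by auto
    qed
  qed
  then show ?thesis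
    using assms tournament_induced_tournament alternation_acyclic_induced_tournament
    unfolding largest_maximal_order_def Let_def by blast
qed

theorem theorem5p3:
  fixes n :: nat and lam :: "nat \<Rightarrow> nat" and p :: "nat \<Rightarrow> enat"
  assumes "lam permutes {1..n}"
    and "parent_function n p"
  shows "largest_maximal_representation n (induced_tournament n lam p) lam p \<longleftrightarrow>
           (\<forall>i. perm_descent n lam i \<longrightarrow> enat (lam (i + 1)) \<in> p ` {1..n})"
proof -
  let ?T = "induced_tournament n lam p"
  let ?le = "right_alternating_walk_le ?T"
  note inv1 = permutes_inverses(1)[OF assms(1)] and inv2 = permutes_inverses(2)[OF assms(1)]
  have lam_in: "lam i \<in> {1..n} \<longleftrightarrow> i \<in> {1..n}" for i
    using assms(1) by (rule permutes_in_image)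
  have "(\<forall>k\<in>{1..n}. \<forall>x\<in>maximal_elements ?le (lam ` {1..k}). x \<le> lam k) \<longleftrightarrow>
      (\<forall>i. perm_descent n lam i \<longrightarrow> enat (lam (i + 1)) \<in> p ` {1..n})" (is "?L \<longleftrightarrow> ?R")
  proof (intro iffI allI impI ballI)
    fix i
    assume L: ?L and "perm_descent n lam i"
    then have i: "1 \<le> i" "i < n" "lam (i + 1) < lam i"
      by (auto simp: perm_descent_def)
    \<comment> \<open>At \<open>k = i + 1\<close> all maximal elements are bounded by
      \<open>lam (i + 1)\<close>, which is less than \<open>lam i\<close>.\<close>
    then have "lam i \<notin> maximal_elements ?le (lam ` {1..i+1})"
      using L by (metis Suc_eq_plus1 Suc_leI atLeastAtMost_iff le_add2 not_le)
    then obtain y where y: "y \<in> lam ` {1..i+1}" "?le (lam i) y" "y \<noteq> lam i"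
      using i by (auto simp: maximal_elements_def)
    obtain w where w: "w \<in> {1..n}" "p w \<noteq> \<infinity>" "inv lam (lam i) < inv lam (the_enat (p w))"
      "inv lam (the_enat (p w)) \<le> inv lam y"
      using right_alternating_walk_le_first_step[OF y(2)] y(3) by metis
    \<comment> \<open>This position comes after \<open>i\<close> and not after that of
      \<open>y\<close>, which is at most \<open>i + 1\<close>.\<close>
    have "inv lam (the_enat (p w)) = i + 1"
      using w y(1) by (auto simp: inv2)
    then have "the_enat (p w) = lam (i + 1)"
      by (metis inv1)
    then have "p w = enat (lam (i + 1))"
      using w(2) by auto
    then show "enat (lam (i + 1)) \<in> p ` {1..n}"
      using w(1) by (metis imageI)
  next
    fix k x
    assume R: ?R and k: "k \<in> {1..n}" and x: "x \<in> maximal_elements ?le (lam ` {1..k})"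
    show "x \<le> lam k"
    proof (rule ccontr)
      assume "\<not> x \<le> lam k"
      obtain j where j: "1 \<le> j" "j \<le> k" "x = lam j"
        using x by (auto simp: maximal_elements_def)
      define b where "b = (LEAST b. j < b \<and> lam b < x)"
      have "j < k \<and> lam k < x"
        using \<open>\<not> x \<le> lam k\<close> j by (metis le_neq_implies_less not_le order_refl)
      then have b: "j < b" "lam b < x" "b \<le> k"
        using LeastI[of "\<lambda>b. j < b \<and> lam b < x" k] Least_le[of "\<lambda>b. j < b \<and> lam b < x" k]
        unfolding b_def by auto
      obtain i where i: "b = i + 1" "j \<le> i"
        using b(1) by (metis Suc_eq_plus1 less_Suc_eq_le less_imp_Suc_add le_add1)
      \<comment> \<open>The entry just before position \<open>b\<close> is \<open>x\<close> itself
        or, by minimality of \<open>b\<close>, not below \<open>x\<close>; so \<open>lam\<close>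
        descends at \<open>i\<close>.\<close>
      have "x \<le> lam i"
        using i j not_less_Least[of i "\<lambda>b. j < b \<and> lam b < x"] unfolding b_def[symmetric]
        by (cases "j = i") auto
      then have "perm_descent n lam i"
        using b i j k by (auto simp: perm_descent_def)
      then obtain w where w: "w \<in> {1..n}" "p w = enat (lam b)"
        using R i by (metis imageE)
      have "w < lam b"
        using assms(2) w unfolding parent_function_def by (metis enat_ord_simps(2))
      \<comment> \<open>As \<open>p w = lam b\<close>, the position inequalities become
        \<open>j < b\<close> and \<open>b \<le> b\<close>; moreover
        \<open>w < lam b < x\<close>.\<close>
      have "descent ?T x w \<and> ascent ?T w (lam b)"
        unfolding descent_ascent_induced_tournament_iff
        using w b j k \<open>w < lam b\<close> lam_in[of j] lam_in[of b] by (auto simp: inv2)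
      then have "?le x (lam b)"
        by (blast intro: right_alternating_walk_le_descent_ascent)
      moreover have "lam b \<in> lam ` {1..k}"
        using b by auto
      ultimately show False
        using x b(2) by (auto simp: maximal_elements_def)
    qed
  qed
  then show ?thesis
    using assms(2) largest_maximal_order_induced_tournament_iff[OF assms(1)]
    by (simp add: largest_maximal_representation_def)
qed

end
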